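(* Let $\alpha,\beta,\gamma,\delta$ be real numbers satisfying the standing assumptions below, and let $\mathcal{P}=\{(A_n,B_n)\mid n\ge 0\}\cup\{(B_n,A_n)\mid n\ge 0\}$. If the $4$-tuple $(\alpha,\beta,\gamma,\delta)$ is not good, then there does not exist any invariant game (on two heaps) whose set of $P$-positions is exactly $\mathcal{P}$.
   Context: Standing assumptions: $\alpha<\beta$ are positive irrational numbers with $\frac1\alpha+\frac1\beta=1$; $\gamma,\delta$ are real numbers with $\gamma\neq 0$, $\frac{\gamma}{\alpha}+\frac{\delta}{\beta}=0$, and $n\beta+\delta\notin\mathbb{Z}$ for all integers $n\ge1$. Set $A_0=B_0=0$ and $A_n=\lfloor n\alpha+\gamma\rfloor$, $B_n=\lfloor n\beta+\delta\rfloor$ for $n\ge1$; assume $A_1=1$ and $B_1\ge 3$. (Then $\{A_n\}_{n\ge1}$ and $\{B_n\}_{n\ge1}$ partition $\mathbb{N}_{>0}$.) Invariant games: positions are pairs $(x,y)\in\mathbb{N}^2$ (two heaps of tokens). A game is given by a set $\mathcal{M}\subseteq\mathbb{N}^2\setminus\{(0,0)\}$ of moves; from $(x,y)$ a player may play any $m\in\mathcal{M}$ with $m\le(x,y)$ componentwise, reaching $(x,y)-m$. Players alternate and the player making the last move wins. A position is a $P$-position iff no move from it leads to a $P$-position (equivalently, the player who is not about to move has a winning strategy). The word $\mathbf{w}=w_0w_1w_2\cdots$: $w_n=(A_{n+1}-A_n,B_{n+1}-B_n)$ for $n\ge0$ (so $w_0=(1,B_1)$). Write $a=(1,\lfloor\beta\rfloor)$,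 $b=(1,\lfloor\beta\rfloor+1)$, $c=(2,\lfloor\beta\rfloor)$, $d=(2,\lfloor\beta\rfloor+1)$; for $n\ge1$, $w_n\in\{a,b,c,d\}$. Let $\pi_1,\pi_2$ be the coordinate projections of pairs. For a finite word $v$, $|v|_x$ is the number of occurrences of the letter $x$, and $\Psi(v)=(|v|_a,|v|_b,|v|_c,|v|_d)$. $\mathrm{Fac}_n(\mathbf{w})$ is the set of factors (blocks of consecutive letters) of length $n$ of $\mathbf{w}$. Bad prefix (used when $\gamma>0$): a prefix $p=w_0u_1\cdots u_n$ of $\mathbf{w}$, with $u=u_1\cdots u_n$, is bad if $u\in\{a,b\}^*$, $u_1\cdots u_{n-1}$ is a palindrome, and one of: (i) $2B_1=\pi_2(u_n)-1$ and there is $v\in\mathrm{Fac}_n(\mathbf{w})$ with $\Psi(v)=\Psi(u)+(0,-1,1,0)$ or $\Psi(v)=\Psi(u)+(1,-2,0,1)$; (ii) $2B_1=\pi_2(u_n)$ and there is $v\in\mathrm{Fac}_n(\mathbf{w})$ with $\Psi(v)=\Psi(u)+(-1,0,1,0)$ or $\Psi(v)=\Psi(u)+(0,-1,0,1)$; (iii) $2B_1=\pi_2(u_n)+1$ and there is $v\in\mathrm{Fac}_n(\mathbf{w})$ with $\Psi(v)=\Psi(u)+(-1,0,0,1)$ or $\Psi(v)=\Psi(u)+(-2,1,1,0)$. Suffix-bad (used when $\gamma<0$): a factor $u=u_1\cdots u_n\in\{a,b\}^*$ of $\mathbf{w}$ satisfies (B.1) if there is $v\in\mathrm{Fac}_n(\mathbf{w})\cap\{a,b\}^*$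 with $\Psi(v)=\Psi(u)+(j,-j,0,0)$ for some $j>0$; it satisfies (B.2) if there is $v'\in\mathrm{Fac}_{n-1}(\mathbf{w})$ with $\Psi(v')=\Psi(u_1\cdots u_{n-1})+(0,-1,1,0)$ or $\Psi(v')=\Psi(u_1\cdots u_{n-1})+(1,-2,0,1)$. Such $u$ is suffix-bad if either all suffixes $u_j\cdots u_n$, $1\le j\le n$, satisfy (B.1), or all suffixes $u_j\cdots u_n$, $1\le j\le n-1$, satisfy (B.2). Good: $(\alpha,\beta,\gamma,\delta)$ is good if either $\gamma>0$ and no prefix $p=w_0w_1\cdots w_k$ with $1\le k\le B_1-2$ and $w_1,\dots,w_k\in\{a,b\}$ is bad; or $\gamma<0$ and no prefix of $\mathbf{w}$ lying in $\{a,b\}^*$ of length less than $B_1$ is suffix-bad.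
   Formalization: In "suffix-bad", the (B.1) alternative is required only for n ≥ 1 and the (B.2) alternative only for n ≥ 2; read literally, empty and one-letter prefixes would be vacuously suffix-bad, making every tuple with γ<0 not good and the claim false. *)

theory Defs
  imports Complex_Main "HOL-Library.Product_Plus" "HOL-Library.Product_Order"
begin

section \<open>Invariant games on two heaps\<close>

text \<open>
  On pairs, \<open>\<le>\<close> and \<open>-\<close> are componentwise. A move set never contains \<open>(0, 0)\<close>; the guard below
  only makes the recursion total in \<open>M\<close> and is without effect on move sets.
\<close>

function P_position :: "(nat \<times> nat) set \<Rightarrow> nat \<times> nat \<Rightarrow> bool" where
  "P_position M p \<longleftrightarrow> (\<forall>m \<in> M - {(0, 0)}. m \<le> p \<longrightarrow> \<not> P_position M (p - m))"
  by auto
termination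
  by (relation "measure (\<lambda>(M, p). fst p + snd p)") auto

declare P_position.simps [simp del]

section \<open>Complementary non-homogeneous Beatty sequences\<close>

definition beatty :: "real \<Rightarrow> real \<Rightarrow> nat \<Rightarrow> int" where
  "beatty \<theta> \<eta> n = (if n = 0 then 0 else \<lfloor>real n * \<theta> + \<eta>\<rfloor>)"

locale complementary_beatty =
  fixes \<alpha> \<beta> \<gamma> \<delta> :: real
  assumes alpha_pos: "0 < \<alpha>"
    and alpha_less_beta: "\<alpha> < \<beta>"
    and alpha_irrational: "\<alpha> \<notin> \<rat>"
    and beta_irrational: "\<beta> \<notin> \<rat>"
    and inverse_sum: "1 / \<alpha> + 1 / \<beta> = 1"
    and gamma_nonzero: "\<gamma> \<noteq> 0"
    and offset_sum: "\<gamma> / \<alpha> + \<delta> / \<beta> = 0"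
    and not_integer: "\<And>n::nat. n \<ge> 1 \<Longrightarrow> real n * \<beta> + \<delta> \<notin> \<int>"
    and A_one: "beatty \<alpha> \<gamma> 1 = 1"
    and B_one: "beatty \<beta> \<delta> 1 \<ge> 3"
begin

definition A_seq :: "nat \<Rightarrow> int" where "A_seq = beatty \<alpha> \<gamma>"
definition B_seq :: "nat \<Rightarrow> int" where "B_seq = beatty \<beta> \<delta>"

text \<open>Both sequences are nonnegative under the assumptions above, so \<open>nat\<close> does not truncate.\<close>

definition target_positions :: "(nat \<times> nat) set" where
  "target_positions =
     range (\<lambda>n. (nat (A_seq n), nat (B_seq n))) \<union> range (\<lambda>n. (nat (B_seq n), nat (A_seq n)))"

definition word :: "nat \<Rightarrow> int \<times> int" where
  "word n = (A_seq (Suc n) - A_seq n, B_seq (Suc n) - B_seq n)"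

definition letter_a :: "int \<times> int" where "letter_a = (1, \<lfloor>\<beta>\<rfloor>)"
definition letter_b :: "int \<times> int" where "letter_b = (1, \<lfloor>\<beta>\<rfloor> + 1)"
definition letter_c :: "int \<times> int" where "letter_c = (2, \<lfloor>\<beta>\<rfloor>)"
definition letter_d :: "int \<times> int" where "letter_d = (2, \<lfloor>\<beta>\<rfloor> + 1)"

text \<open>
  The initial letter \<open>word 0\<close> need not be one of the four letters. Blocks containing it are factors
  all the same.
\<close>

definition Fac :: "nat \<Rightarrow> (int \<times> int) list set" where
  "Fac n = range (\<lambda>i. map word [i..<i + n])"

definition \<Psi> :: "(int \<times> int) list \<Rightarrow> int \<times> int \<times> int \<times> int" where
  "\<Psi> v = (int (count_list v letter_a), int (count_list v letter_b),
          int (count_list v letter_c), int (count_list v letter_d))"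

definition word_prefix :: "nat \<Rightarrow> (int \<times> int) list" where
  "word_prefix n = map word [0..<n]"

definition bad_prefix :: "(int \<times> int) list \<Rightarrow> bool" where
  "bad_prefix p \<longleftrightarrow>
     (\<exists>n u. n \<ge> 1 \<and> length u = n \<and> p = word_prefix (Suc n) \<and> p = word 0 # u \<and>
        set u \<subseteq> {letter_a, letter_b} \<and> rev (butlast u) = butlast u \<and>
        ((2 * B_seq 1 = snd (last u) - 1 \<and>
            (\<exists>v \<in> Fac n. \<Psi> v = \<Psi> u + (0, -1, 1, 0) \<or> \<Psi> v = \<Psi> u + (1, -2, 0, 1))) \<or>
         (2 * B_seq 1 = snd (last u) \<and>
            (\<exists>v \<in> Fac n. \<Psi> v = \<Psi> u + (-1, 0, 1, 0) \<or> \<Psi> v = \<Psi> u + (0, -1, 0, 1))) \<or>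
         (2 * B_seq 1 = snd (last u) + 1 \<and>
            (\<exists>v \<in> Fac n. \<Psi> v = \<Psi> u + (-1, 0, 0, 1) \<or> \<Psi> v = \<Psi> u + (-2, 1, 1, 0)))))"

definition property_B1 :: "(int \<times> int) list \<Rightarrow> bool" where
  "property_B1 u \<longleftrightarrow>
     (\<exists>v \<in> Fac (length u). set v \<subseteq> {letter_a, letter_b} \<and>
        (\<exists>j>0. \<Psi> v = \<Psi> u + (j, -j, 0, 0)))"

definition property_B2 :: "(int \<times> int) list \<Rightarrow> bool" where
  "property_B2 u \<longleftrightarrow>
     (\<exists>v \<in> Fac (length u - 1).
        \<Psi> v = \<Psi> (butlast u) + (0, -1, 1, 0) \<or> \<Psi> v = \<Psi> (butlast u) + (1, -2, 0, 1))"

text \<open>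
  The suffix \<open>drop j u\<close> is \<open>u\<^sub>j\<^sub>+\<^sub>1 \<dots> u\<^sub>n\<close>. The length bounds keep the quantifications over suffixes
  from being vacuous: without them the empty word, and every one-letter word over the letters
  \<open>a\<close> and \<open>b\<close>, would be suffix-bad.
\<close>

definition suffix_bad :: "(int \<times> int) list \<Rightarrow> bool" where
  "suffix_bad u \<longleftrightarrow>
     u \<in> Fac (length u) \<and> set u \<subseteq> {letter_a, letter_b} \<and>
     ((length u \<ge> 1 \<and> (\<forall>j < length u. property_B1 (drop j u))) \<or>
      (length u \<ge> 2 \<and> (\<forall>j < length u - 1. property_B2 (drop j u))))"

definition good :: bool where
  "good \<longleftrightarrow>
     (\<gamma> > 0 \<and>
        (\<forall>k. 1 \<le> k \<and> int k \<le> B_seq 1 - 2 \<and> set (map word [1..<Suc k]) \<subseteq> {letter_a, letter_b} \<longrightarrow>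
           \<not> bad_prefix (word_prefix (Suc k)))) \<or>
     (\<gamma> < 0 \<and>
        (\<forall>n. int n < B_seq 1 \<and> set (word_prefix n) \<subseteq> {letter_a, letter_b} \<longrightarrow>
           \<not> suffix_bad (word_prefix n)))"

end

end

theory Submission
  imports Defs
begin

text \<open>
  A move of an invariant game with \<open>P\<close>-positions \<open>T\<close> is never a difference of two elements of \<open>T\<close>.
  Hence no such game exists once some \<open>x \<notin> T\<close> has the property that \<open>x - q\<close> is a difference of
  elements of \<open>T\<close> for every \<open>q \<in> T\<close> below \<open>x\<close>. Each kind of badness yields such an \<open>x\<close>. If
  \<open>\<gamma> > 0\<close> and \<open>w\<^sub>0u\<^sub>1\<cdots>u\<^sub>n\<close> is a bad prefix, take \<open>x = (n + 1, B\<^sub>n + B\<^sub>1)\<close>: the factor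
  \<open>v\<close> realises \<open>x - (0, 0)\<close>, and since \<open>u\<^sub>1\<cdots>u\<^sub>n\<^sub>-\<^sub>1\<close> is a palindrome, \<open>x - (A\<^sub>k, B\<^sub>k)\<close> is the
  \<open>P\<close>-position \<open>(A\<^sub>n\<^sub>+\<^sub>1\<^sub>-\<^sub>k, B\<^sub>n\<^sub>+\<^sub>1\<^sub>-\<^sub>k)\<close> for \<open>1 \<le> k \<le> n\<close>. If \<open>\<gamma> < 0\<close> and a prefix of length
  \<open>n\<close> is suffix-bad, take \<open>x = (n, B\<^sub>n - 1)\<close> when (B.1) holds for all suffixes and
  \<open>x = (n, B\<^sub>n\<^sub>-\<^sub>1 - 1)\<close> when (B.2) does.
\<close>

section \<open>Invariant games and differences of P-positions\<close>

lemma no_game_if_differences_cover: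
  assumes "x \<notin> T"
    and "\<And>q. q \<in> T \<Longrightarrow> q \<le> x \<Longrightarrow> \<exists>p' q'. p' \<in> T \<and> q' \<in> T \<and> q' \<le> p' \<and> p' - q' = x - q"
  shows "{p. P_position M p} \<noteq> T"
proof
  assume T: "{p. P_position M p} = T"
  with assms(1) have "\<not> P_position M x" by auto
  then obtain m where m: "m \<in> M - {(0, 0)}" "m \<le> x" "P_position M (x - m)"
    by (subst (asm) P_position.simps) blast
  \<comment> \<open>The covering hypothesis is applied to the P-position \<open>q = x - m\<close>
    reached by \<open>m\<close>: as \<open>m = x - q\<close>, it would move from the P-position
    \<open>p'\<close> to the P-position \<open>q'\<close>.\<close>
  have "x - m \<le> x" "x - (x - m) = m"
    using m(2) by (cases x; cases m; auto)+
  then obtain p' q' where *: "p' \<in> T" "q' \<in> T" "q' \<le> p'" "p' - q' = m"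
    using assms(2)[of "x - m"] m(3) T by auto
  then have "m \<le> p'" "p' - m = q'"
    by (cases p'; cases q'; auto)+
  then show False
    using * m(1) T P_position.simps[of M p'] by auto
qed

context complementary_beatty
begin

section \<open>Growth of the Beatty sequences and positions below a point\<close>

lemma alpha_gt_1: "1 < \<alpha>"
proof -
  have "0 < 1 / \<beta>" using alpha_pos alpha_less_beta by simp
  then have "1 / \<alpha> < 1" using inverse_sum by linarith
  then show ?thesis using alpha_pos by (simp add: divide_less_eq)
qed

lemma A_seq_0 [simp]: "A_seq 0 = 0" and B_seq_0 [simp]: "B_seq 0 = 0"
  by (simp_all add: A_seq_def B_seq_def beatty_def)

lemma floor_Suc_mult_less:
  fixes \<theta> \<eta> :: real
  assumes "1 < \<theta>"
  shows "\<lfloor>real k * \<theta> + \<eta>\<rfloor> < \<lfloor>real (Suc k) * \<theta> + \<eta>\<rfloor>"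
proof -
  have "real k * \<theta> + \<eta> + 1 \<le> real (Suc k) * \<theta> + \<eta>"
    using assms by (simp add: algebra_simps)
  then have "\<lfloor>real k * \<theta> + \<eta> + 1\<rfloor> \<le> \<lfloor>real (Suc k) * \<theta> + \<eta>\<rfloor>"
    by (rule floor_mono)
  then show ?thesis by simp
qed

lemma strict_mono_beatty:
  assumes "1 < \<theta>" "0 < beatty \<theta> \<eta> 1"
  shows "strict_mono (beatty \<theta> \<eta>)"
proof (rule strict_mono_Suc_iff[THEN iffD2], rule allI)
  \<comment> \<open>At \<open>k = 0\<close> the value is 0 by convention and not the floor of
    \<eta>, so positivity of the first term is used there.\<close>
  fix k show "beatty \<theta> \<eta> k < beatty \<theta> \<eta> (Suc k)"
    using assms(2) floor_Suc_mult_less[OF assms(1), of k \<eta>] by (cases "k = 0") (simp_all add: beatty_def)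
qed

lemma strict_mono_A_seq: "strict_mono A_seq"
  unfolding A_seq_def using alpha_gt_1 A_one by (intro strict_mono_beatty) auto

lemma strict_mono_B_seq: "strict_mono B_seq"
  unfolding B_seq_def using alpha_gt_1 alpha_less_beta B_one by (intro strict_mono_beatty) auto

lemma A_seq_nonneg: "0 \<le> A_seq k"
  using strict_mono_less_eq[OF strict_mono_A_seq, of 0 k] by simp

lemma B_seq_nonneg: "0 \<le> B_seq k"
  using strict_mono_less_eq[OF strict_mono_B_seq, of 0 k] by simp

lemma B_seq_ge_first: "1 \<le> k \<Longrightarrow> B_seq 1 \<le> B_seq k"
  using strict_mono_less_eq[OF strict_mono_B_seq, of 1 k] by simp

text \<open>
  Since \<open>n\<close> is smaller than \<open>B\<^sub>1\<close>, no mirrored position \<open>(B\<^sub>k, A\<^sub>k)\<close> with \<open>k \<ge> 1\<close> lies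
  below \<open>(n, y)\<close>.
\<close>

lemma no_game_if_sequence_differences_cover:
  fixes n :: nat and y :: int
  assumes A: "\<And>k. k \<le> n \<Longrightarrow> A_seq k = int k"
    and n: "int n < B_seq 1"
    and y: "0 \<le> y" "y < B_seq n"
    and cover: "\<And>k. k < n \<Longrightarrow> B_seq k \<le> y \<Longrightarrow>
      \<exists>i j. A_seq j - A_seq i = int n - int k \<and> B_seq j - B_seq i = y - B_seq k"
  shows "{p. P_position M p} \<noteq> target_positions"
proof (rule no_game_if_differences_cover)
  let ?P = "\<lambda>k. (nat (A_seq k), nat (B_seq k))"
  have below: "\<exists>k < n. q = ?P k \<and> B_seq k \<le> y"
    if q: "q \<in> target_positions" "q \<le> (n, nat y)" for q
  proof -
    \<comment> \<open>The mirrored position of index 0 is (0, 0), which the first case already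
      contains.\<close>
    consider k where "q = ?P k" | k where "k \<ge> 1" "q = (nat (B_seq k), nat (A_seq k))"
      using q(1) unfolding target_positions_def
      by (metis (no_types, lifting) A_seq_0 B_seq_0 UnE imageE less_one not_le)
    then show ?thesis
    proof cases
      case 1
      then have le: "A_seq k \<le> int n" "B_seq k \<le> y"
        using q(2) y(1) by auto
      then have "B_seq k < B_seq n" using y(2) by simp
      then have "k < n" using strict_mono_less[OF strict_mono_B_seq] by blast
      then show ?thesis using 1 le by blast
    next
      case 2
      then show ?thesis using q(2) n B_seq_ge_first[of k] by auto
    qed
  qed
  show "(n, nat y) \<notin> target_positions"
  proof
    assume "(n, nat y) \<in> target_positions"
    from below[OF this] obtain k where "k < n" "n = nat (A_seq k)" by auto
    then show False using A[of k] by (metis less_imp_le less_irrefl nat_int)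
  qed
  fix q assume "q \<in> target_positions" "q \<le> (n, nat y)"
  from below[OF this] obtain k where k: "k < n" "q = ?P k" "B_seq k \<le> y" by auto
  from cover[OF k(1,3)] obtain i j where
    ij: "A_seq j - A_seq i = int n - int k" "B_seq j - B_seq i = y - B_seq k" by blast
  have "?P j \<in> target_positions" "?P i \<in> target_positions"
    by (auto simp: target_positions_def)
  \<comment> \<open>By \<open>k < n\<close> and \<open>B\<^sub>k \<le> y\<close> both differences
    are nonnegative, so truncated subtraction is exact.\<close>
  moreover have "?P i \<le> ?P j" "?P j - ?P i = (n, nat y) - q"
    using ij k A[of k] A_seq_nonneg[of i] B_seq_nonneg[of i] B_seq_nonneg[of k] by auto
  ultimately show "\<exists>p' q'. p' \<in> target_positions \<and> q' \<in> target_positions \<and> q' \<le> p' \<and>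
      p' - q' = (n, nat y) - q"
    by blast
qed

section \<open>Letter counts and sums over factors\<close>

lemma letters_distinct:
  "letter_a \<noteq> letter_b" "letter_a \<noteq> letter_c" "letter_a \<noteq> letter_d"
  "letter_b \<noteq> letter_c" "letter_b \<noteq> letter_d" "letter_c \<noteq> letter_d"
  by (auto simp: letter_a_def letter_b_def letter_c_def letter_d_def)

lemma sum_list_word: "i \<le> j \<Longrightarrow> sum_list (map word [i..<j]) = (A_seq j - A_seq i, B_seq j - B_seq i)"
  by (induction j rule: dec_induct) (auto simp: word_def zero_prod_def)

text \<open>The last summand counts entries outside the four letters, such as possibly
  \<open>w\<^sub>0\<close>; if the four counts add up to the length, it vanishes.\<close>

lemma length_eq_counts:
  assumes "\<Psi> v = (p, q, r, s)"
  shows "int (length v) = p + q + r + s +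
    int (length (filter (\<lambda>x. x \<notin> {letter_a, letter_b, letter_c, letter_d}) v))"
  using assms letters_distinct by (induction v arbitrary: p q r s) (auto simp: \<Psi>_def)

lemma sum_list_eq_counts:
  assumes "\<Psi> v = (p, q, r, s)" "int (length v) = p + q + r + s"
  shows "sum_list v = (p + q + 2 * r + 2 * s, (p + q + r + s) * \<lfloor>\<beta>\<rfloor> + q + s)"
proof -
  have "set v \<subseteq> {letter_a, letter_b, letter_c, letter_d}"
    using length_eq_counts[OF assms(1)] assms(2) by (auto simp: filter_empty_conv)
  then show ?thesis
    using assms(1)
  proof (induction v arbitrary: p q r s)
    case Nil
    then show ?case by (simp add: \<Psi>_def zero_prod_def)
  next
    case (Cons x v)
    obtain p' q' r' s' where v: "\<Psi> v = (p', q', r', s')"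
      by (metis prod_cases4)
    have "sum_list v = (p' + q' + 2 * r' + 2 * s', (p' + q' + r' + s') * \<lfloor>\<beta>\<rfloor> + q' + s')"
      using Cons.IH[OF _ v] Cons.prems(1) by simp
    then show ?case
      using Cons.prems v letters_distinct
      by (auto simp: \<Psi>_def letter_a_def letter_b_def letter_c_def letter_d_def algebra_simps)
  qed
qed

text \<open>Since the shift has total 0, the counts of \<open>v\<close> fill its whole length, so
  \<open>v\<close> uses only the four letters. Each \<open>c\<close> or \<open>d\<close> gained adds
  1 to the first coordinate, each \<open>b\<close> or \<open>d\<close> gained adds 1 to the
  second.\<close>

lemma factor_difference:
  assumes v: "v \<in> Fac (length u)" and u: "set u \<subseteq> {letter_a, letter_b}"
    and \<Psi>: "\<Psi> v = \<Psi> u + (p, q, r, s)" and "p + q + r + s = 0"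
  shows "\<exists>i. (A_seq (i + length u) - A_seq i, B_seq (i + length u) - B_seq i) =
    sum_list u + (r + s, q + s)"
proof -
  obtain p' q' r' s' where \<Psi>u: "\<Psi> u = (p', q', r', s')"
    by (metis prod_cases4)
  have "filter (\<lambda>x. x \<notin> {letter_a, letter_b, letter_c, letter_d}) u = []"
    using u by (auto simp: filter_empty_conv)
  then have lu: "int (length u) = p' + q' + r' + s'"
    using length_eq_counts[OF \<Psi>u] by simp
  obtain i where i: "v = map word [i..<i + length u]"
    using v by (auto simp: Fac_def)
  have \<Psi>v: "\<Psi> v = (p' + p, q' + q, r' + r, s' + s)"
    using \<Psi> \<Psi>u by simp
  have sum: "p' + p + (q' + q) + (r' + r) + (s' + s) = p' + q' + r' + s'"
    and shift: "p = - (q + r + s)"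
    using assms(4) by simp_all
  have "int (length v) = p' + p + (q' + q) + (r' + r) + (s' + s)"
    using i lu sum by simp
  from sum_list_eq_counts[OF \<Psi>v this] sum_list_eq_counts[OF \<Psi>u lu]
  have "sum_list v = sum_list u + (r + s, q + s)"
    unfolding sum by (simp add: shift)
  then show ?thesis
    using i sum_list_word[of i "i + length u"] by auto
qed

lemma A_seq_eq_index:
  assumes "set (map word [1..<n]) \<subseteq> {letter_a, letter_b}" "k \<le> n"
  shows "A_seq k = int k"
  using assms(2)
proof (induction k)
  case (Suc k)
  have "A_seq (Suc k) - A_seq k = 1"
  proof (cases "k = 0")
    case True
    then show ?thesis using A_one by (simp add: A_seq_def beatty_def)
  next
    case False
    then have "word k \<in> set (map word [1..<n])" using Suc.prems by simp
    then have "word k \<in> {letter_a, letter_b}" using assms(1) by blast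
    then show ?thesis by (auto simp: word_def letter_a_def letter_b_def)
  qed
  then show ?case using Suc by simp
qed simp

section \<open>Bad prefixes: the case of positive \<gamma>\<close>

lemma no_game_if_bad_prefix:
  assumes n: "int n \<le> B_seq 1 - 2" and bad: "bad_prefix (word_prefix (Suc n))"
  shows "{p. P_position M p} \<noteq> target_positions"
proof -
  let ?u = "map word [1..<Suc n]"
  have prefix: "word_prefix (Suc n) = word 0 # ?u"
    by (simp add: word_prefix_def upt_conv_Cons del: upt_Suc)
  have len: "n' = n" if "word_prefix (Suc n) = word_prefix (Suc n')" for n'
    using arg_cong[OF that, of length] by (simp add: word_prefix_def)
  have n1: "1 \<le> n" and u: "set ?u \<subseteq> {letter_a, letter_b}"
    and pal: "rev (butlast ?u) = butlast ?u"
    and cases: "(2 * B_seq 1 = snd (last ?u) - 1 \<and>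
            (\<exists>v \<in> Fac n. \<Psi> v = \<Psi> ?u + (0, -1, 1, 0) \<or> \<Psi> v = \<Psi> ?u + (1, -2, 0, 1))) \<or>
         (2 * B_seq 1 = snd (last ?u) \<and>
            (\<exists>v \<in> Fac n. \<Psi> v = \<Psi> ?u + (-1, 0, 1, 0) \<or> \<Psi> v = \<Psi> ?u + (0, -1, 0, 1))) \<or>
         (2 * B_seq 1 = snd (last ?u) + 1 \<and>
            (\<exists>v \<in> Fac n. \<Psi> v = \<Psi> ?u + (-1, 0, 0, 1) \<or> \<Psi> v = \<Psi> ?u + (-2, 1, 1, 0)))"
    using bad len prefix unfolding bad_prefix_def by (metis list.inject)+
  have last_u: "snd (last ?u) = B_seq (Suc n) - B_seq n"
    using n1 by (simp add: word_def)
  have B1: "3 \<le> B_seq 1" using B_one by (simp add: B_seq_def)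
  \<comment> \<open>The clauses (i), (ii), (iii) are \<open>e = -1, 0, 1\<close>. In each, both
    shifts add \<open>(1, e)\<close> to the sum of \<open>u\<close>, which turns it into
    \<open>(n + 1, B\<^sub>n + B\<^sub>1)\<close>.\<close>
  obtain e where e: "2 * B_seq 1 = B_seq (Suc n) - B_seq n + e" "e \<le> 1"
    and v: "\<exists>v p q r s. v \<in> Fac (length ?u) \<and> \<Psi> v = \<Psi> ?u + (p, q, r, s) \<and>
      p + q + r + s = 0 \<and> r + s = 1 \<and> q + s = e"
  proof -
    have fac: "\<exists>v p q r s. v \<in> Fac (length ?u) \<and> \<Psi> v = \<Psi> ?u + (p, q, r, s) \<and>
      p + q + r + s = 0 \<and> r + s = 1 \<and> q + s = e"
      if "v \<in> Fac n" "\<Psi> v = \<Psi> ?u + (p, q, r, s)" "p + q + r + s = 0" "r + s = 1" "q + s = e"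
      for v p q r s e
      using that by (intro exI[of _ v] exI[of _ p] exI[of _ q] exI[of _ r] exI[of _ s])
        (simp del: upt_Suc)
    consider "2 * B_seq 1 = snd (last ?u) - 1"
        "\<exists>v \<in> Fac n. \<Psi> v = \<Psi> ?u + (0, -1, 1, 0) \<or> \<Psi> v = \<Psi> ?u + (1, -2, 0, 1)"
      | "2 * B_seq 1 = snd (last ?u)"
        "\<exists>v \<in> Fac n. \<Psi> v = \<Psi> ?u + (-1, 0, 1, 0) \<or> \<Psi> v = \<Psi> ?u + (0, -1, 0, 1)"
      | "2 * B_seq 1 = snd (last ?u) + 1"
        "\<exists>v \<in> Fac n. \<Psi> v = \<Psi> ?u + (-1, 0, 0, 1) \<or> \<Psi> v = \<Psi> ?u + (-2, 1, 1, 0)"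
      using cases by blast
    then show ?thesis
    proof cases
      case 1
      show ?thesis by (rule that[of "-1"]) (use 1 last_u fac in \<open>fastforce+\<close>)
    next
      case 2
      show ?thesis by (rule that[of "0"]) (use 2 last_u fac in \<open>fastforce+\<close>)
    next
      case 3
      show ?thesis by (rule that[of "1"]) (use 3 last_u fac in \<open>fastforce+\<close>)
    qed
  qed
  have A: "A_seq k = int k" if "k \<le> Suc n" for k
    using A_seq_eq_index[OF u that] .
  \<comment> \<open>By the palindrome, \<open>w\<^sub>k \<dots> w\<^sub>n\<^sub>-\<^sub>1\<close> is
    the reversal of \<open>w\<^sub>1 \<dots> w\<^sub>n\<^sub>-\<^sub>k\<close>, so the two blocks
    have equal sums.\<close>
  have mirror: "B_seq n - B_seq k = B_seq (Suc n - k) - B_seq 1" if k: "1 \<le> k" "k \<le> n" for k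
  proof -
    have u': "butlast ?u = map word [1..<n]" using n1 by simp
    have "map word [k..<n] = drop (k - 1) (butlast ?u)"
      using k unfolding u' by (simp add: drop_map)
    also have "\<dots> = rev (take (n - k) (butlast ?u))"
      using k pal by (simp add: u' rev_take del: upt_Suc)
    also have "take (n - k) (butlast ?u) = map word [1..<Suc n - k]"
      using k unfolding u' by (simp add: take_map take_upt Suc_diff_le)
    finally have "sum_list (map word [k..<n]) = sum_list (map word [1..<Suc n - k])"
      by (simp add: sum_list_rev)
    then show ?thesis
      using k sum_list_word[of k n] sum_list_word[of 1 "Suc n - k"] by simp
  qed
  show ?thesis
  proof (rule no_game_if_sequence_differences_cover)
    show "int (Suc n) < B_seq 1" using n by simp
    show "0 \<le> B_seq n + B_seq 1" using B_seq_nonneg by simp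
    \<comment> \<open>The gap is \<open>2 * B\<^sub>1 - e\<close>, which exceeds
      \<open>B\<^sub>1\<close> as \<open>e \<le> 1\<close> and
      \<open>B\<^sub>1 \<ge> 3\<close>.\<close>
    show "B_seq n + B_seq 1 < B_seq (Suc n)" using e B1 by linarith
    fix k assume k: "k < Suc n"
    show "\<exists>i j. A_seq j - A_seq i = int (Suc n) - int k \<and>
        B_seq j - B_seq i = B_seq n + B_seq 1 - B_seq k"
    proof (cases "k = 0")
      case True
      from v factor_difference[OF _ u] obtain i where
        "(A_seq (i + length ?u) - A_seq i, B_seq (i + length ?u) - B_seq i) =
          sum_list ?u + (1, e)"
        by metis
      then have "A_seq (i + length ?u) - A_seq i = int (Suc n) - int k \<and>
          B_seq (i + length ?u) - B_seq i = B_seq n + B_seq 1 - B_seq k"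
        using sum_list_word[of 1 "Suc n"] A[of 1] A[of "Suc n"] True e(1) n1 by simp
      then show ?thesis by blast
    next
      case False
      then have "A_seq (Suc n - k) - A_seq 0 = int (Suc n) - int k \<and>
          B_seq (Suc n - k) - B_seq 0 = B_seq n + B_seq 1 - B_seq k"
        using k mirror[of k] A[of "Suc n - k"] by simp
      then show ?thesis by blast
    qed
  qed (use A in simp)
qed

section \<open>Suffix-bad prefixes: the case of negative \<gamma>\<close>

text \<open>From \<open>A\<^sub>1 = 1\<close> comes \<open>- \<gamma> \<le> \<alpha> - 1\<close>;
  the upper bound follows by \<open>\<delta> * \<alpha> = - \<gamma> * \<beta>\<close> and
  \<open>(\<alpha> - 1) * \<beta> = \<alpha>\<close>.\<close>

lemma delta_bounds:
  assumes "\<gamma> < 0"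
  shows "0 < \<delta>" "\<delta> \<le> 1"
proof -
  have pos: "0 < \<alpha>" "0 < \<beta>" using alpha_pos alpha_less_beta by auto
  have sum: "\<alpha> + \<beta> = \<alpha> * \<beta>"
    using inverse_sum pos by (simp add: field_simps)
  have "\<gamma> * \<beta> + \<delta> * \<alpha> = 0"
    using offset_sum pos by (simp add: field_simps)
  then have \<delta>: "\<delta> * \<alpha> = - \<gamma> * \<beta>" by simp
  have "0 < \<delta> * \<alpha>"
    unfolding \<delta> using assms pos by (simp add: mult_neg_pos)
  then show "0 < \<delta>" using pos(1) by (rule zero_less_mult_pos2)
  have "1 \<le> \<alpha> + \<gamma>" using A_one by (simp add: beatty_def floor_eq_iff)
  then have "- \<gamma> * \<beta> \<le> (\<alpha> - 1) * \<beta>"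
    using pos by (intro mult_right_mono) auto
  also have "\<dots> = 1 * \<alpha>" using sum by (simp add: algebra_simps)
  finally have "\<delta> * \<alpha> \<le> 1 * \<alpha>" using \<delta> by simp
  then show "\<delta> \<le> 1" using pos by simp
qed

text \<open>
  The junk value \<open>B\<^sub>0 = 0\<close> differs from \<open>\<lfloor>\<delta>\<rfloor>\<close> in the extreme case \<open>\<delta> = 1\<close>, yet the bounds survive.
\<close>

lemma B_seq_difference_bounds:
  assumes "\<gamma> < 0"
  shows "\<lfloor>real m * \<beta>\<rfloor> \<le> B_seq (i + m) - B_seq i" "B_seq (i + m) - B_seq i \<le> \<lfloor>real m * \<beta>\<rfloor> + 1"
  using delta_bounds[OF assms]
  by (cases "i = 0"; cases "m = 0"; simp add: B_seq_def beatty_def algebra_simps; linarith)+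

lemma no_game_if_suffix_bad:
  assumes "\<gamma> < 0" and n: "int n < B_seq 1" and bad: "suffix_bad (word_prefix n)"
  shows "{p. P_position M p} \<noteq> target_positions"
proof -
  have len: "length (word_prefix n) = n" by (simp add: word_prefix_def)
  have set_n: "set (word_prefix n) \<subseteq> {letter_a, letter_b}"
    using bad by (simp add: suffix_bad_def)
  have letters: "set (map word [k..<m]) \<subseteq> {letter_a, letter_b}" if "m \<le> n" for k m
  proof (rule subset_trans[OF _ set_n])
    show "set (map word [k..<m]) \<subseteq> set (word_prefix n)"
      using that by (auto simp: word_prefix_def)
  qed
  have A: "A_seq k = int k" if "k \<le> n" for k
    using letters that by (intro A_seq_eq_index[of n]) simp_all
  have suffix: "drop k (word_prefix n) = map word [k..<n]" for k
    by (simp add: word_prefix_def drop_map)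
  consider (B1) "1 \<le> n" "\<And>k. k < n \<Longrightarrow> property_B1 (map word [k..<n])"
    | (B2) "2 \<le> n" "\<And>k. k < n - 1 \<Longrightarrow> property_B2 (map word [k..<n])"
    using bad unfolding suffix_bad_def len suffix by blast
  then show ?thesis
  proof cases
    case B1
    show ?thesis
    proof (rule no_game_if_sequence_differences_cover[OF A n])
      show "0 \<le> B_seq n - 1"
        using B1(1) strict_mono_less[OF strict_mono_B_seq, of 0 n] by simp
      show "B_seq n - 1 < B_seq n" by simp
      fix k assume k: "k < n"
      let ?u = "map word [k..<n]"
      obtain v l where v: "v \<in> Fac (length ?u)" "0 < l" "\<Psi> v = \<Psi> ?u + (l, - l, 0, 0)"
        using B1(2)[OF k] unfolding property_B1_def by blast
      from factor_difference[OF v(1) letters v(3)] obtain i where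
        i: "(A_seq (i + length ?u) - A_seq i, B_seq (i + length ?u) - B_seq i) =
          sum_list ?u + (0, - l)"
        by auto
      have "B_seq (i + (n - k)) - B_seq i = B_seq n - B_seq k - l"
        using i sum_list_word[of k n] k by simp
      \<comment> \<open>Blocks of equal length have second coordinates summing to one of two
        consecutive integers, so a positive drop is exactly 1.\<close>
      then have "l = 1"
        using v(2) B_seq_difference_bounds[OF assms(1), where m = "n - k" and i = i]
          B_seq_difference_bounds[OF assms(1), where m = "n - k" and i = k] k
        by (simp del: of_nat_diff)
      then have "A_seq (i + length ?u) - A_seq i = int n - int k \<and>
          B_seq (i + length ?u) - B_seq i = B_seq n - 1 - B_seq k"
        using i sum_list_word[of k n] k A[of k] A[of n] by simp
      then show "\<exists>i j. A_seq j - A_seq i = int n - int k \<and>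
          B_seq j - B_seq i = B_seq n - 1 - B_seq k"
        by blast
    qed
  next
    case B2
    show ?thesis
    proof (rule no_game_if_sequence_differences_cover[OF A n])
      show "0 \<le> B_seq (n - 1) - 1"
        using B2(1) strict_mono_less[OF strict_mono_B_seq, of 0 "n - 1"] by simp
      show "B_seq (n - 1) - 1 < B_seq n"
        using strict_mono_less_eq[OF strict_mono_B_seq, of "n - 1" n] by simp
      \<comment> \<open>Positions below \<open>x\<close> have \<open>k \<le> n - 2\<close>, which
        matches the suffixes of length at least 2 in (B.2).\<close>
      fix k assume "k < n" "B_seq k \<le> B_seq (n - 1) - 1"
      then have k: "k < n - 1"
        using strict_mono_less[OF strict_mono_B_seq, of k "n - 1"] by simp
      let ?u = "map word [k..<n - 1]"
      have "butlast (map word [k..<n]) = ?u"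
        using k by (cases n) simp_all
      then obtain v where v: "v \<in> Fac (length ?u)"
        and \<Psi>: "\<Psi> v = \<Psi> ?u + (0, -1, 1, 0) \<or> \<Psi> v = \<Psi> ?u + (1, -2, 0, 1)"
        using B2(2)[OF k] unfolding property_B2_def by auto
      \<comment> \<open>Both shifts in (B.2) add \<open>(1, -1)\<close>: the first entry makes up
        for the dropped last letter, the second gives the \<open>-1\<close> in
        \<open>x\<close>.\<close>
      then obtain i where "(A_seq (i + length ?u) - A_seq i, B_seq (i + length ?u) - B_seq i) =
          sum_list ?u + (1, -1)"
        using factor_difference[OF v letters] by fastforce
      then have "A_seq (i + length ?u) - A_seq i = int n - int k \<and>
          B_seq (i + length ?u) - B_seq i = B_seq (n - 1) - 1 - B_seq k"
        using sum_list_word[of k "n - 1"] k A[of k] A[of "n - 1"] by simp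
      then show "\<exists>i j. A_seq j - A_seq i = int n - int k \<and>
          B_seq j - B_seq i = B_seq (n - 1) - 1 - B_seq k"
        by blast
    qed
  qed
qed

end

theorem theorem3:
  fixes \<alpha> \<beta> \<gamma> \<delta> :: real
  assumes "complementary_beatty \<alpha> \<beta> \<gamma> \<delta>"
    and "\<not> complementary_beatty.good \<alpha> \<beta> \<gamma> \<delta>"
  shows "\<not> (\<exists>M :: (nat \<times> nat) set. (0, 0) \<notin> M \<and>
           {p. P_position M p} = complementary_beatty.target_positions \<alpha> \<beta> \<gamma> \<delta>)"
proof -
  interpret complementary_beatty \<alpha> \<beta> \<gamma> \<delta> by (fact assms(1))
  have "{p. P_position M p} \<noteq> target_positions" for M
  proof (cases "\<gamma> > 0")
    case True
    then show ?thesis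
      using assms(2) no_game_if_bad_prefix unfolding good_def by blast
  next
    case False
    then have "\<gamma> < 0" using gamma_nonzero by simp
    then show ?thesis
      using assms(2) no_game_if_suffix_bad unfolding good_def by blast
  qed
  then show ?thesis by blast
qed

end
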